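(* $$\int_0^1 \ln(-\ln x)\,\frac{1}{1+x^2}\,dx = \frac{\pi}{2}\,\ln\frac{\sqrt{2\pi}\,\Gamma\left(\frac34\right)}{\Gamma\left(\frac14\right)}.$$
   Context: $\Gamma$ denotes the gamma function. *)

theory Defs
  imports "HOL-Analysis.Analysis"
begin

end

theory Submission
  imports Defs
    "HOL-Complex_Analysis.Complex_Analysis" "HOL-Real_Asymp.Real_Asymp"
begin

text \<open>
  The substitution \<open>x = exp (- t)\<close> turns the integral into \<open>K 0 / 4\<close>, where \<open>K s\<close> is the integral of
  \<open>ln (s\<^sup>2 + y\<^sup>2) / cosh y\<close> over \<open>y > 0\<close>. Since \<open>cos w\<close> changes sign under \<open>w \<mapsto> w + pi\<close> and equals \<open>cosh y\<close>
  at \<open>w = i y\<close>, integrating \<open>Ln (w + s) / cos w\<close> around the strip \<open>0 \<le> Re w \<le> pi\<close> and taking the residue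
  at \<open>pi / 2\<close> gives \<open>K s + K (s + pi) = 2 pi ln (s + pi / 2)\<close>. Iterating this relation from \<open>s = 0\<close>, together
  with \<open>K s = pi ln s + o(1)\<close>, expresses \<open>K 0\<close> as the logarithm of an infinite product, which Euler's limit
  formula for the Gamma function evaluates.
\<close>

section \<open>Absolute integrability and dependence on the parameter\<close>

definition log_sech_integral :: "real \<Rightarrow> real" where
  "log_sech_integral s = integral {0<..} (\<lambda>y. ln (s\<^sup>2 + y\<^sup>2) / cosh y)"

lemma inverse_cosh_le: "1 / cosh y \<le> 2 / exp (y::real)"
proof -
  have "exp y / 2 \<le> cosh y" by (simp add: cosh_field_def)
  then have "1 / cosh y \<le> 1 / (exp y / 2)" by (intro divide_left_mono) auto
  then show ?thesis by simp
qed

lemma powr_over_exp_integrable: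
  assumes "a > -1"
  shows "(\<lambda>t::real. t powr a / exp t) integrable_on {0<..}"
proof -
  have "((\<lambda>t. t powr a / exp t) has_integral Gamma (a + 1)) {0..}"
    using Gamma_integral_real[of "a + 1"] assms by simp
  then have "((\<lambda>t. t powr a / exp t) has_integral Gamma (a + 1)) {0<..}"
    by (subst has_integral_spike_set_eq[where T = "{0..}"])
      (auto intro: negligible_subset[of "{0}"])
  then show ?thesis by blast
qed

text \<open>
  The term \<open>y powr (-1/2)\<close> dominates the logarithmic singularity at \<open>y = 0\<close> uniformly in \<open>s\<close>, so the bound also
  serves to pass to the limit \<open>s \<longrightarrow> 0\<close>.
\<close>

definition log_sech_bound :: "real \<Rightarrow> real \<Rightarrow> real" where
  "log_sech_bound S y = (S\<^sup>2 + y\<^sup>2 + 4 * y powr (-1/2)) * (2 / exp y)"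

lemma log_sech_bound_integrable: "log_sech_bound S integrable_on {0<..}"
proof -
  have "(\<lambda>y::real. 2 * S\<^sup>2 * (y powr 0 / exp y) + 2 * (y powr 2 / exp y)
      + 8 * (y powr (-1/2) / exp y)) integrable_on {0<..}"
    by (intro integrable_add integrable_on_mult_right powr_over_exp_integrable) auto
  then show ?thesis
    by (rule integrable_eq) (auto simp: log_sech_bound_def field_simps)
qed

lemma log_sech_le_bound:
  assumes "y > 0" "\<bar>s\<bar> \<le> S"
  shows "\<bar>ln (s\<^sup>2 + y\<^sup>2) / cosh y\<bar> \<le> log_sech_bound S y"
proof -
  have pos: "s\<^sup>2 + y\<^sup>2 > 0" using assms by (simp add: add_nonneg_pos)
  have "s\<^sup>2 \<le> S\<^sup>2" using assms by (simp add: abs_le_square_iff[symmetric])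
  then have up: "ln (s\<^sup>2 + y\<^sup>2) \<le> S\<^sup>2 + y\<^sup>2" using ln_le_minus_one[OF pos] by linarith
  have "ln (y\<^sup>2) \<le> ln (s\<^sup>2 + y\<^sup>2)" using pos assms by (subst ln_le_cancel_iff) auto
  moreover have "ln (y\<^sup>2) = 2 * ln y" using assms by (simp add: ln_realpow)
  \<comment> \<open>This is \<open>ln u <= u - 1\<close> at \<open>u = y powr (-1/2)\<close>.
    Multiplied by 4 it bounds \<open>- 2 * ln y = - ln (y^2)\<close>, which is where the coefficient
    4 in \<open>log_sech_bound\<close> comes from.\<close>
  moreover have "(-1/2) * ln y \<le> y powr (-1/2)"
    using ln_le_minus_one[of "y powr (-1/2)"] assms by (simp add: ln_powr)
  ultimately have lo: "- ln (s\<^sup>2 + y\<^sup>2) \<le> 4 * y powr (-1/2)" by linarith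
  have "\<bar>ln (s\<^sup>2 + y\<^sup>2)\<bar> \<le> S\<^sup>2 + y\<^sup>2 + 4 * y powr (-1/2)"
    using up lo by (smt (verit) powr_ge_zero zero_le_power2)
  then have "\<bar>ln (s\<^sup>2 + y\<^sup>2)\<bar> * (1 / cosh y) \<le> log_sech_bound S y"
    unfolding log_sech_bound_def using inverse_cosh_le[of y]
    by (intro mult_mono) auto
  then show ?thesis by (simp add: abs_mult)
qed

lemma log_sech_absolutely_integrable:
  fixes s :: real
  shows "(\<lambda>y. ln (s\<^sup>2 + y\<^sup>2) / cosh y) absolutely_integrable_on {0<..}"
proof (rule measurable_bounded_by_integrable_imp_absolutely_integrable)
  have "s\<^sup>2 + y\<^sup>2 \<noteq> 0" if "y > 0" for y
    using that by (simp add: add_nonneg_eq_0_iff)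
  then show "(\<lambda>y. ln (s\<^sup>2 + y\<^sup>2) / cosh y) \<in> borel_measurable (lebesgue_on {0<..})"
    by (intro continuous_imp_measurable_on_sets_lebesgue continuous_intros) auto
  show "norm (ln (s\<^sup>2 + y\<^sup>2) / cosh y) \<le> log_sech_bound \<bar>s\<bar> y" if "y \<in> {0<..}" for y
    using log_sech_le_bound[of y s "\<bar>s\<bar>"] that by simp
qed (simp_all add: log_sech_bound_integrable)

lemma log_sech_integrable:
  fixes s :: real
  shows "(\<lambda>y. ln (s\<^sup>2 + y\<^sup>2) / cosh y) integrable_on {0<..}"
  by (rule set_lebesgue_integral_eq_integral(1)[OF log_sech_absolutely_integrable])

text \<open>Continuity from the right along one sequence is enough to carry the functional equation
  from positive parameters to 0. All parameters of the sequence have absolute value at most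
  \<open>1 + \<bar>a\<bar>\<close>, so a single dominating function serves for every
  \<open>n\<close>.\<close>

lemma log_sech_integral_tendsto: "(\<lambda>n. log_sech_integral (1 / real (Suc n) + a)) \<longlonglongrightarrow> log_sech_integral a"
  unfolding log_sech_integral_def
proof (rule dominated_convergence(2))
  show "norm (ln ((1 / real (Suc n) + a)\<^sup>2 + y\<^sup>2) / cosh y) \<le> log_sech_bound (1 + \<bar>a\<bar>) y"
    if "y \<in> {0<..}" for n y
  proof -
    have "1 / real (Suc n) \<le> 1" "1 / real (Suc n) \<ge> 0" by auto
    then have "\<bar>1 / real (Suc n) + a\<bar> \<le> 1 + \<bar>a\<bar>" by linarith
    then show ?thesis using log_sech_le_bound that by simp
  qed
  show "(\<lambda>n. ln ((1 / real (Suc n) + a)\<^sup>2 + y\<^sup>2) / cosh y) \<longlonglongrightarrow> ln (a\<^sup>2 + y\<^sup>2) / cosh y"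
    if "y \<in> {0<..}" for y
  proof -
    have "a\<^sup>2 + y\<^sup>2 \<noteq> 0" using that by (simp add: add_nonneg_eq_0_iff)
    moreover have "(\<lambda>n. 1 / real (Suc n)) \<longlonglongrightarrow> 0" by real_asymp
    ultimately show ?thesis
      using tendsto_ln[OF tendsto_add[OF tendsto_power[OF tendsto_add[OF _ tendsto_const]] tendsto_const],
          of "\<lambda>n. 1 / real (Suc n)" 0 sequentially a 2 "y\<^sup>2"]
      by (intro tendsto_divide tendsto_const) (simp_all only: add_0 cosh_real_nonzero not_False_eq_True)
  qed
qed (rule log_sech_integrable log_sech_bound_integrable)+

section \<open>Limits of truncated integrals, and growth for large parameters\<close>

lemma integral_Icc_0_tendsto:
  fixes f :: "real \<Rightarrow> real"
  assumes "f absolutely_integrable_on {0<..}"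
  shows "(\<lambda>n. integral {0..real n} f) \<longlonglongrightarrow> integral {0<..} f"
proof -
  \<comment> \<open>Truncating the integrand instead of the domain puts all integrals on one set,
    where \<bar>f\<bar> itself dominates.\<close>
  let ?g = "\<lambda>n x. if x \<in> {0<..<real n} then f x else 0"
  have int: "f integrable_on {0<..<real n}" for n
    by (intro set_lebesgue_integral_eq_integral(1) set_integrable_subset[OF assms]) auto
  have "(\<lambda>n. integral {0<..} (?g n)) \<longlonglongrightarrow> integral {0<..} f"
  proof (rule dominated_convergence(2))
    show "?g n integrable_on {0<..}" for n
      using int[of n] by (subst integrable_restrict_Int) (auto simp: Int_absorb2 greaterThanLessThan_def)
    show "(\<lambda>x. \<bar>f x\<bar>) integrable_on {0<..}"
      using assms by (simp add: absolutely_integrable_on_def)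
    show "(\<lambda>n. ?g n x) \<longlonglongrightarrow> f x" if "x \<in> {0<..}" for x
    proof (rule tendsto_eventually)
      show "\<forall>\<^sub>F n in sequentially. ?g n x = f x"
        using filterlim_real_sequentially[unfolded filterlim_at_top_dense, rule_format, of x]
        by eventually_elim (use that in auto)
    qed
  qed auto
  moreover have "integral {0<..} (?g n) = integral {0..real n} f" for n
    unfolding integral_open_interval_real integral_restrict_Int
    by (rule arg_cong[where f = "\<lambda>A. integral A f"]) auto
  ultimately show ?thesis by simp
qed

lemma sech_absolutely_integrable: "(\<lambda>y::real. 1 / cosh y) absolutely_integrable_on {0<..}"
proof (rule measurable_bounded_by_integrable_imp_absolutely_integrable)
  show "(\<lambda>y::real. 1 / cosh y) \<in> borel_measurable (lebesgue_on {0<..})"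
    by (intro continuous_imp_measurable_on_sets_lebesgue continuous_intros) auto
  have "(\<lambda>y::real. 2 * (y powr 0 / exp y)) integrable_on {0<..}"
    by (intro integrable_on_mult_right powr_over_exp_integrable) auto
  then show "(\<lambda>y::real. 2 / exp y) integrable_on {0<..}"
    by (rule integrable_eq) auto
qed (use inverse_cosh_le in auto)

text \<open>The Gudermannian \<open>arctan (sinh y)\<close> is an antiderivative, since
  \<open>1 + sinh^2 = cosh^2\<close>, and it rises from 0 to pi / 2. This value fixes the leading
  coefficient pi in the asymptotics below.\<close>

lemma has_integral_sech: "((\<lambda>y::real. 1 / cosh y) has_integral pi / 2) {0<..}"
proof -
  have "((\<lambda>y::real. 1 / cosh y) has_integral arctan (sinh (real n)) - arctan (sinh 0)) {0..real n}" for n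
  proof (rule fundamental_theorem_of_calculus)
    show "((\<lambda>y. arctan (sinh y)) has_vector_derivative 1 / cosh y) (at y within {0..real n})" for y
      unfolding has_real_derivative_iff_has_vector_derivative[symmetric]
    proof -
      have "((\<lambda>y. arctan (sinh y)) has_real_derivative inverse (1 + (sinh y)\<^sup>2) * cosh y)
          (at y within {0..real n})"
        by (intro DERIV_chain2[OF DERIV_arctan] has_field_derivative_sinh[THEN DERIV_cong]) (auto intro!: derivative_eq_intros)
      moreover have "1 + (sinh y)\<^sup>2 = (cosh y)\<^sup>2" using cosh_square_eq[of y] by simp
      ultimately show "((\<lambda>y. arctan (sinh y)) has_real_derivative 1 / cosh y) (at y within {0..real n})"
        by (simp add: power2_eq_square field_simps)
    qed
  qed auto
  then have "integral {0..real n} (\<lambda>y. 1 / cosh y) = arctan (sinh (real n))" for n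
    using integral_unique by fastforce
  then have "(\<lambda>n. arctan (sinh (real n))) \<longlonglongrightarrow> integral {0<..} (\<lambda>y::real. 1 / cosh y)"
    using integral_Icc_0_tendsto[OF sech_absolutely_integrable] by simp
  moreover have "(\<lambda>n. arctan (sinh (real n))) \<longlonglongrightarrow> pi / 2"
    by (rule filterlim_compose[OF tendsto_arctan_at_top]) (simp add: sinh_field_def, real_asymp)
  ultimately have eq: "integral {0<..} (\<lambda>y::real. 1 / cosh y) = pi / 2"
    using LIMSEQ_unique by blast
  then show ?thesis
    using integrable_integral[OF set_lebesgue_integral_eq_integral(1)[OF sech_absolutely_integrable]]
    by (simp only: eq)
qed

text \<open>Factoring \<open>s^2\<close> out of the logarithm splits off \<open>2 * ln s\<close>
  times the integral of \<open>1 / cosh y\<close>, that is \<open>pi * ln s\<close>. What remains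
  has \<open>ln (1 + y^2 / s^2) <= y^2 / s^2\<close> as numerator, so the error is O(1 /
  s^2).\<close>

lemma log_sech_integral_asymp:
  assumes c: "c > 0"
  shows "(\<lambda>n. log_sech_integral (c * real (Suc n)) - pi * ln (c * real (Suc n))) \<longlonglongrightarrow> 0"
proof -
  \<comment> \<open>With \<open>S = 0\<close> the bound still dominates
    \<open>y^2 * (2 / exp y)\<close>, so its known integrability can be reused.\<close>
  define J where "J = integral {0<..} (\<lambda>y. log_sech_bound 0 y)"
  have bnd: "\<bar>log_sech_integral s - pi * ln s\<bar> \<le> J / s\<^sup>2" if s: "s > 0" for s
  proof -
    let ?h = "\<lambda>y. ln (s\<^sup>2 + y\<^sup>2) / cosh y - 2 * ln s * (1 / cosh y)"
    have "(?h has_integral (log_sech_integral s - 2 * ln s * (pi / 2))) {0<..}"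
      unfolding log_sech_integral_def
      by (intro has_integral_diff integrable_integral log_sech_integrable
          has_integral_mult_right has_integral_sech)
    then have h: "(?h has_integral (log_sech_integral s - pi * ln s)) {0<..}"
      by (simp add: mult.commute)
    have "norm (integral {0<..} ?h) \<le> integral {0<..} (\<lambda>y. (1 / s\<^sup>2) * log_sech_bound 0 y)"
    proof (rule integral_norm_bound_integral)
      fix y :: real assume "y \<in> {0<..}"
      then have y: "y > 0" by simp
      have pos: "1 + y\<^sup>2 / s\<^sup>2 > 0" by (intro add_pos_nonneg) auto
      have eq: "?h y = ln (1 + y\<^sup>2 / s\<^sup>2) * (1 / cosh y)"
      proof -
        have "ln (s\<^sup>2 + y\<^sup>2) = ln (s\<^sup>2 * (1 + y\<^sup>2 / s\<^sup>2))"
          using s by (simp add: distrib_left)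
        also have "\<dots> = 2 * ln s + ln (1 + y\<^sup>2 / s\<^sup>2)"
          using s pos by (simp add: ln_mult ln_realpow)
        finally show ?thesis by (simp add: field_simps)
      qed
      have "0 \<le> ln (1 + y\<^sup>2 / s\<^sup>2)" by simp
      moreover have "ln (1 + y\<^sup>2 / s\<^sup>2) \<le> y\<^sup>2 / s\<^sup>2" by (rule ln_add_one_self_le_self) simp
      ultimately have "norm (?h y) \<le> (y\<^sup>2 / s\<^sup>2) * (2 / exp y)"
        unfolding eq using inverse_cosh_le[of y] by (simp only: real_norm_def abs_mult, intro mult_mono) auto
      also have "\<dots> \<le> (1 / s\<^sup>2) * log_sech_bound 0 y"
        unfolding log_sech_bound_def times_divide_eq_left mult.assoc[symmetric]
        by (intro mult_right_mono divide_right_mono) auto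
      finally show "norm (?h y) \<le> (1 / s\<^sup>2) * log_sech_bound 0 y" .
    qed (rule has_integral_integrable[OF h] integrable_on_mult_right log_sech_bound_integrable)+
    then show ?thesis using h by (simp add: integral_unique J_def)
  qed
  show ?thesis
  proof (rule Lim_null_comparison)
    show "(\<lambda>n. J / (c * real (Suc n))\<^sup>2) \<longlonglongrightarrow> 0" using c by real_asymp
    show "\<forall>\<^sub>F n in sequentially. norm (log_sech_integral (c * real (Suc n)) - pi * ln (c * real (Suc n)))
        \<le> J / (c * real (Suc n))\<^sup>2"
      by (intro always_eventually allI) (unfold real_norm_def, rule bnd, use c in simp)
  qed
qed

section \<open>The functional equation by residues\<close>

lemma cos_eq_0_strip:
  assumes "cos w = 0" "- (pi / 2) < Re w" "Re w < 3 * pi / 2"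
  shows "w = of_real (pi / 2)"
proof -
  \<comment> \<open>The real part of \<open>cos w\<close> is
    \<open>cos (Re w) * cosh (Im w)\<close>, whose second factor is positive, so \<open>Re w\<close>
    must be the only zero of the real cosine in the range. There the sine is 1, and the imaginary
    part forces \<open>sinh (Im w) = 0\<close>.\<close>
  have "exp (Im w) + exp (- Im w) > 0" by (simp add: add_pos_pos)
  moreover have "cos (Re w) * (exp (Im w) + exp (- Im w)) = 0"
    using arg_cong[OF assms(1), of Re] by (simp add: Re_cos)
  ultimately have cos0: "cos (Re w) = 0" by simp
  then have "sin (Re w - pi / 2) = 0" by (simp add: sin_diff)
  then have re: "Re w = pi / 2"
    using sin_eq_0_pi[of "Re w - pi / 2"] assms by auto
  have "sin (Re w) * (exp (- Im w) - exp (Im w)) = 0"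
    using arg_cong[OF assms(1), of Im] by (simp add: Im_cos)
  then have "Im w = 0" using re by simp
  with re show ?thesis by (simp add: complex_eq_iff)
qed

text \<open>Holds because \<open>\<bar>cos (x + i y)\<bar>^2 = cos^2 x + sinh^2 y\<close>. The bound
  does not depend on the real part, so it controls a whole horizontal side of the contour.\<close>

lemma norm_cos_ge_sinh: "sinh \<bar>Im z\<bar> \<le> norm (cos z)"
proof -
  have "(sinh \<bar>Im z\<bar>)\<^sup>2 = (exp (Im z) - inverse (exp (Im z)))\<^sup>2 / 4"
    by (simp add: sinh_field_def exp_minus abs_if power2_eq_square field_simps)
  also have "\<dots> \<le> (norm (cos z))\<^sup>2" by (simp add: norm_cos_squared)
  finally show ?thesis using power2_le_imp_le norm_ge_zero by blast
qed

text \<open>For norm at least 1 the real part \<open>ln (norm z)\<close> is nonnegative and below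
  \<open>norm z\<close>. Linear growth is crude but loses to the sinh in the denominator.\<close>

lemma norm_Ln_le_norm:
  assumes "norm z \<ge> 1"
  shows "norm (Ln z) \<le> norm z + pi"
proof -
  have "z \<noteq> 0" using assms by auto
  have "norm (Ln z) \<le> \<bar>Re (Ln z)\<bar> + \<bar>Im (Ln z)\<bar>" by (rule cmod_le)
  moreover have "\<bar>Im (Ln z)\<bar> \<le> pi" using mpi_less_Im_Ln[of z] Im_Ln_le_pi[of z] \<open>z \<noteq> 0\<close> by linarith
  moreover have "\<bar>Re (Ln z)\<bar> \<le> norm z"
    using assms \<open>z \<noteq> 0\<close> ln_le_minus_one[of "norm z"] by simp
  ultimately show ?thesis by linarith
qed

lemma rectangle_Ln_div_cos:
  fixes s T :: real
  assumes s: "s > 0" and T: "T > 0"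
  defines "f \<equiv> \<lambda>w. Ln (w + of_real s) / cos w"
  shows "contour_integral (rectpath (Complex 0 (-T)) (Complex pi T)) f
           = - 2 * pi * \<i> * Ln (of_real (s + pi / 2))" (is "?I = _")
    and "f analytic_on path_image (rectpath (Complex 0 (-T)) (Complex pi T))"
proof -
  \<comment> \<open>The left edge \<open>- m\<close> of the strip \<open>S\<close> keeps it clear of
    both the branch cut of \<open>Ln (w + s)\<close>, which ends at \<open>- s\<close>, and the zero
    of cos at - pi / 2. The right edge 3 pi / 2 is the next zero after pi / 2.\<close>
  define m where "m = min s (pi / 2)"
  define S where "S = {w. - m < Re w} \<inter> {w. Re w < 3 * pi / 2}"
  have m: "m > 0" "m \<le> s" "m \<le> pi / 2" using s by (auto simp: m_def)
  have S: "open S" "connected S"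
    unfolding S_def by (auto intro!: open_Int open_halfspace_Re_gt open_halfspace_Re_lt convex_connected
        convex_Int convex_halfspace_Re_gt convex_halfspace_Re_lt simp del: divide_less_eq_numeral1 less_divide_eq_numeral1)
  have Ln: "(\<lambda>w. Ln (w + of_real s)) holomorphic_on S"
    using m by (intro holomorphic_intros) (auto simp: S_def complex_nonpos_Reals_iff)
  have cos: "cos w \<noteq> 0" if "w \<in> S - {of_real (pi / 2)}" for w
    using cos_eq_0_strip[of w] that m by (auto simp: S_def)
  have holo: "f holomorphic_on S - {of_real (pi / 2)}"
    unfolding f_def by (intro holomorphic_intros holomorphic_on_subset[OF Ln] cos) auto
  let ?a = "Complex 0 (-T)" and ?b = "Complex pi T"
  have sub: "path_image (rectpath ?a ?b) \<subseteq> S - {of_real (pi / 2)}"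
    using T m by (subst path_image_rectpath) (auto simp: S_def)
  show "f analytic_on path_image (rectpath ?a ?b)"
    using holo S sub by (meson analytic_on_holomorphic finite.emptyI finite_insert open_delete)
  have mem: "of_real (pi / 2) \<in> S" using m by (auto simp: S_def)
  have "residue f (of_real (pi / 2)) = Ln (of_real (pi / 2) + of_real s) / (-1)"
    unfolding f_def
  proof (rule residue_simple_pole_deriv[OF Ln _ S mem])
    have "sin (complex_of_real pi / 2) = 1"
      using sin_of_real[of "pi/2", where 'a=complex] by simp
    then show "(cos has_field_derivative -1) (at (complex_of_real (pi / 2)))"
      by (auto intro!: derivative_eq_intros)
    \<comment> \<open>The residue rule for simple poles wants a nonzero numerator, and
      \<open>s + pi / 2 > 1\<close> keeps the logarithm away from its zero.\<close>
    have "ln (pi / 2 + s) > 0" using s pi_gt3 by (intro ln_gt_zero) linarith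
    then have "Ln (of_real (pi / 2 + s)) \<noteq> 0"
      using s by (subst Ln_of_real) (auto simp: add_pos_pos)
    then show "Ln (complex_of_real (pi / 2) + complex_of_real s) \<noteq> 0" by simp
    show "cos (complex_of_real (pi / 2)) = 0" by (metis cos_of_real cos_pi_half of_real_0)
  qed (auto intro: holomorphic_intros)
  then have res: "residue f (of_real (pi / 2)) = - Ln (of_real (s + pi / 2))" by (simp add: add.commute)
  have "?I = 2 * pi * \<i> * (\<Sum>p\<in>{of_real (pi / 2)}. winding_number (rectpath ?a ?b) p * residue f p)"
  proof (rule Residue_theorem[OF S _ holo _ _ sub])
    show "\<forall>z. z \<notin> S \<longrightarrow> winding_number (rectpath ?a ?b) z = 0"
      using T m by (auto intro!: winding_number_rectpath_outside simp: S_def in_cbox_complex_iff)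
  qed auto
  moreover have "winding_number (rectpath ?a ?b) (of_real (pi / 2)) = 1"
    using T by (intro winding_number_rectpath) (auto simp: in_box_complex_iff)
  ultimately show "?I = - 2 * pi * \<i> * Ln (of_real (s + pi / 2))" using res by simp
qed

lemma integral_even:
  fixes g :: "real \<Rightarrow> real"
  assumes "continuous_on {-T..T} g" "T \<ge> 0" "\<And>x. g (-x) = g x"
  shows "integral {-T..T} g = 2 * integral {0..T} g"
proof -
  have "integral {-T..0} g + integral {0..T} g = integral {-T..T} g"
    using assms
    by (intro Henstock_Kurzweil_Integration.integral_combine integrable_continuous_interval) auto
  moreover have "integral {-T..0} g = integral {0..T} g"
    using Henstock_Kurzweil_Integration.integral_reflect_real[of T 0 g] assms(3) by simp
  ultimately show ?thesis by simp
qed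

text \<open>The vertical sides of the rectangle give the two integrals and the residue gives the
  logarithm. The error comes from the horizontal sides, two segments of length pi on which the
  integrand is at most \<open>(s + T + 2 * pi) / sinh T\<close>. \<open>T >= 1\<close> ensures that
  \<open>w + s\<close> has norm at least 1 there.\<close>

lemma truncated_log_sech_functional_equation:
  fixes s T :: real
  assumes s: "s > 0" and T: "T \<ge> 1"
  defines "g \<equiv> \<lambda>y. ln (s\<^sup>2 + y\<^sup>2) / cosh y + ln ((s + pi)\<^sup>2 + y\<^sup>2) / cosh y"
  shows "\<bar>integral {0..T} g - 2 * pi * ln (s + pi / 2)\<bar> \<le> 2 * pi * ((s + T + 2 * pi) / sinh T)"
proof -
  define f where "f = (\<lambda>w. Ln (w + of_real s) / cos w)"
  define B where "B = (s + T + 2 * pi) / sinh T"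
  define a1 a2 a3 a4 where "a1 = Complex 0 (-T)" and "a2 = Complex pi (-T)"
    and "a3 = Complex pi T" and "a4 = Complex 0 T"
  note a_defs = a1_def a2_def a3_def a4_def
  have T0: "T > 0" using T by simp
  have rect: "rectpath a1 a3 = linepath a1 a2 +++ linepath a2 a3 +++ linepath a3 a4 +++ linepath a4 a1"
    by (simp add: rectpath_def a_defs Let_def)
  have "continuous_on (path_image (rectpath a1 a3)) f"
    using rectangle_Ln_div_cos(2)[OF s T0] unfolding f_def a_defs
    by (intro holomorphic_on_imp_continuous_on analytic_imp_holomorphic)
  then have seg: "continuous_on (closed_segment p q) f"
    if "(p, q) \<in> {(a1, a2), (a2, a3), (a3, a4), (a4, a1)}" for p q
    using that by (elim continuous_on_subset) (auto simp: rect path_image_join)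
  then have int: "f contour_integrable_on linepath p q"
    if "(p, q) \<in> {(a1, a2), (a2, a3), (a3, a4), (a4, a1)}" for p q
    using that by (intro contour_integrable_continuous_linepath seg)
  have B0: "B \<ge> 0" using s T by (simp add: B_def)
  have bound: "norm (f w) \<le> B" if "0 \<le> Re w" "Re w \<le> pi" "\<bar>Im w\<bar> = T" for w
  proof -
    have "T \<le> norm (w + of_real s)" using abs_Im_le_cmod[of "w + of_real s"] that by simp
    moreover have "norm (w + of_real s) \<le> s + T + pi"
      using cmod_le[of "w + of_real s"] that s by simp
    ultimately have "norm (Ln (w + of_real s)) \<le> s + T + 2 * pi"
      using norm_Ln_le_norm[of "w + of_real s"] T by simp
    then show ?thesis unfolding f_def B_def norm_divide
      using norm_cos_ge_sinh[of w] that T s by (intro frac_le) auto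
  qed
  have "norm (contour_integral (linepath a1 a2) f) \<le> B * norm (a2 - a1)"
    by (intro contour_integral_bound_linepath int B0 bound)
      (use T in \<open>auto simp: a_defs closed_segment_same_Im closed_segment_eq_real_ivl split: if_splits\<close>)
  then have I1: "norm (contour_integral (linepath a1 a2) f) \<le> B * pi"
    by (simp add: a_defs cmod_def)
  have "norm (contour_integral (linepath a3 a4) f) \<le> B * norm (a4 - a3)"
    by (intro contour_integral_bound_linepath int B0 bound)
      (use T in \<open>auto simp: a_defs closed_segment_same_Im closed_segment_eq_real_ivl split: if_splits\<close>)
  then have I3: "norm (contour_integral (linepath a3 a4) f) \<le> B * pi"
    by (simp add: a_defs cmod_def)
  define h where "h = (\<lambda>c y. Ln (Complex c y) / of_real (cosh y))"
  \<comment> \<open>The sign change of cos between the vertical sides compensates for their opposite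
    orientations: both contribute \<open>- \<i>\<close> times an integral of \<open>h\<close>, so
    the integrals add up.\<close>
  have cosh: "cos (Complex 0 y) = of_real (cosh y)" "cos (Complex pi y) = - of_real (cosh y)" for y
    by (simp_all add: complex_eq_iff Re_cos Im_cos cosh_field_def field_simps)
  have "contour_integral (linepath a2 a3) f = \<i> * integral {-T..T} (\<lambda>y. f (Complex pi y))"
    using T by (intro contour_integral_linepath_same_Re) (auto simp: a_defs)
  also have "(\<lambda>y. f (Complex pi y)) = (\<lambda>y. - h (s + pi) y)"
    by (simp add: fun_eq_iff f_def h_def cosh) (simp add: Complex_eq add_ac)
  finally have I2: "contour_integral (linepath a2 a3) f = - \<i> * integral {-T..T} (h (s + pi))"
    by simp
  have "contour_integral (linepath a4 a1) f = - contour_integral (linepath a1 a4) f"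
    using seg[of a4 a1] by (intro contour_integral_reverse_linepath) simp
  also have "contour_integral (linepath a1 a4) f = \<i> * integral {-T..T} (\<lambda>y. f (Complex 0 y))"
    using T by (intro contour_integral_linepath_same_Re) (auto simp: a_defs)
  also have "(\<lambda>y. f (Complex 0 y)) = h s"
    by (simp add: fun_eq_iff f_def h_def cosh) (simp add: Complex_eq add_ac)
  finally have I4: "contour_integral (linepath a4 a1) f = - \<i> * integral {-T..T} (h s)"
    by simp
  have h_int: "h c integrable_on {-T..T}" if "c > 0" for c
  proof -
    have "continuous_on {-T..T} (\<lambda>y. Ln (of_real c + \<i> * of_real y) / of_real (cosh y))"
      using that by (intro continuous_intros) (auto simp: complex_nonpos_Reals_iff)
    then show ?thesis
      unfolding h_def Complex_eq by (rule integrable_continuous_interval)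
  qed
  have Re_h: "Re (h c y) = (ln (c\<^sup>2 + y\<^sup>2) / cosh y) / 2" if "c > 0" for c y
  proof -
    have "c\<^sup>2 + y\<^sup>2 > 0" using that by (simp add: add_pos_nonneg)
    moreover have "Complex c y \<noteq> 0" using that by (simp add: complex_eq_iff)
    ultimately show ?thesis by (simp add: h_def cmod_def ln_sqrt)
  qed
  have Re_int: "Re (integral {-T..T} (h c)) = (1 / 2) * integral {-T..T} (\<lambda>y. ln (c\<^sup>2 + y\<^sup>2) / cosh y)"
    if "c > 0" for c
    using integral_linear[OF h_int[OF that] bounded_linear_Re] Re_h[OF that]
    by (simp add: o_def del: divide_divide_eq_left)
  have cont: "continuous_on A (\<lambda>y. ln (c\<^sup>2 + y\<^sup>2) / cosh y)" if "c > 0" for A :: "real set" and c :: real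
  proof -
    have "c\<^sup>2 + y\<^sup>2 \<noteq> 0" for y using that by (simp add: add_nonneg_eq_0_iff)
    then show ?thesis by (intro continuous_intros) auto
  qed
  \<comment> \<open>The 1 / 2 from \<open>Re (Ln z) = ln (\<bar>z\<bar>^2) / 2\<close> cancels
    against the 2 from folding the even integrand onto \<open>{0..T}\<close>.\<close>
  have Re_int': "Re (integral {-T..T} (h c)) = integral {0..T} (\<lambda>y. ln (c\<^sup>2 + y\<^sup>2) / cosh y)"
    if "c > 0" for c
    using integral_even[OF cont[OF that], of T] T Re_int[OF that] by simp
  define A where "A = integral {-T..T} (h (s + pi)) + integral {-T..T} (h s)"
  have ReA: "Re A = integral {0..T} g"
    unfolding A_def g_def using s
    by (subst integral_add) (auto intro!: integrable_continuous_interval cont simp: Re_int' add_pos_pos)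
  have "contour_integral (rectpath a1 a3) f = contour_integral (linepath a1 a2) f
      + (contour_integral (linepath a2 a3) f + (contour_integral (linepath a3 a4) f
      + contour_integral (linepath a4 a1) f))"
    unfolding rect by (simp add: int)
  also have "\<dots> = contour_integral (linepath a1 a2) f + contour_integral (linepath a3 a4) f - \<i> * A"
    by (simp add: I2 I4 A_def algebra_simps)
  finally have "\<i> * (A - of_real (2 * pi * ln (s + pi / 2)))
      = contour_integral (linepath a1 a2) f + contour_integral (linepath a3 a4) f"
    using rectangle_Ln_div_cos(1)[OF s T0] s Ln_of_real[of "s + pi / 2"]
    by (simp add: f_def a_defs add_pos_pos algebra_simps del: Ln_of_real)
  then have "norm (A - of_real (2 * pi * ln (s + pi / 2)))
      = norm (contour_integral (linepath a1 a2) f + contour_integral (linepath a3 a4) f)"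
    by (metis mult_1 norm_ii norm_mult)
  also have "\<dots> \<le> 2 * pi * B"
    using I1 I3 by (intro norm_triangle_le) (simp add: mult.commute)
  finally have "\<bar>Re (A - of_real (2 * pi * ln (s + pi / 2)))\<bar> \<le> 2 * pi * B"
    using abs_Re_le_cmod order_trans by blast
  then show ?thesis by (simp add: ReA B_def)
qed

lemma log_sech_functional_equation_pos:
  assumes s: "s > 0"
  shows "log_sech_integral s + log_sech_integral (s + pi) = 2 * pi * ln (s + pi / 2)"
proof -
  define g where "g = (\<lambda>y. ln (s\<^sup>2 + y\<^sup>2) / cosh y + ln ((s + pi)\<^sup>2 + y\<^sup>2) / cosh y)"
  have "g absolutely_integrable_on {0<..}"
    unfolding g_def by (intro set_integral_add(1) log_sech_absolutely_integrable)
  then have "(\<lambda>n. integral {0..real n} g) \<longlonglongrightarrow> integral {0<..} g"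
    by (rule integral_Icc_0_tendsto)
  also have "integral {0<..} g = log_sech_integral s + log_sech_integral (s + pi)"
    unfolding g_def log_sech_integral_def by (intro integral_add log_sech_integrable)
  finally have lim: "(\<lambda>n. integral {0..real n} g) \<longlonglongrightarrow> log_sech_integral s + log_sech_integral (s + pi)" .
  have "(\<lambda>n. integral {0..real n} g - 2 * pi * ln (s + pi / 2)) \<longlonglongrightarrow> 0"
  proof (rule Lim_null_comparison)
    show "(\<lambda>n. 2 * pi * ((s + real n + 2 * pi) / sinh (real n))) \<longlonglongrightarrow> 0"
      unfolding sinh_field_def by real_asymp
    show "\<forall>\<^sub>F n in sequentially. norm (integral {0..real n} g - 2 * pi * ln (s + pi / 2))
        \<le> 2 * pi * ((s + real n + 2 * pi) / sinh (real n))"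
      using eventually_ge_at_top[of 1] unfolding g_def real_norm_def
      by eventually_elim (rule truncated_log_sech_functional_equation[OF s], simp)
  qed
  then have "(\<lambda>n. integral {0..real n} g) \<longlonglongrightarrow> 2 * pi * ln (s + pi / 2)"
    by (simp add: LIM_zero_iff)
  with lim show ?thesis by (rule LIMSEQ_unique)
qed

text \<open>At \<open>s = 0\<close> the branch point of the logarithm lies on the contour, so this
  case is reached as a limit from the right.\<close>

lemma log_sech_functional_equation:
  assumes "s \<ge> 0"
  shows "log_sech_integral s + log_sech_integral (s + pi) = 2 * pi * ln (s + pi / 2)"
proof (rule LIMSEQ_unique)
  let ?t = "\<lambda>n. 1 / real (Suc n)"
  have t: "?t \<longlonglongrightarrow> 0" by real_asymp
  show "(\<lambda>n. log_sech_integral (?t n + s) + log_sech_integral (?t n + (s + pi)))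
      \<longlonglongrightarrow> log_sech_integral s + log_sech_integral (s + pi)"
    by (intro tendsto_add log_sech_integral_tendsto)
  have "s + pi / 2 > 0" using assms by (simp add: add_nonneg_pos)
  then have "(\<lambda>n. 2 * pi * ln (?t n + (s + pi / 2))) \<longlonglongrightarrow> 2 * pi * ln (0 + (s + pi / 2))"
    by (intro tendsto_mult tendsto_ln tendsto_add tendsto_const t) simp
  moreover have "log_sech_integral (?t n + s) + log_sech_integral (?t n + (s + pi))
      = 2 * pi * ln (?t n + (s + pi / 2))" for n
    using log_sech_functional_equation_pos[of "?t n + s"] assms
    by (simp add: add.assoc add_pos_nonneg)
  ultimately show "(\<lambda>n. log_sech_integral (?t n + s) + log_sech_integral (?t n + (s + pi)))
      \<longlonglongrightarrow> 2 * pi * ln (s + pi / 2)"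
    by simp
qed

section \<open>Iteration and evaluation by Gamma values\<close>

lemma log_sech_integral_0_eq_pochhammer:
  "log_sech_integral 0 = 2 * pi * ln (pochhammer (1 / 4) m / pochhammer (3 / 4) m)
     + log_sech_integral (2 * pi * real m)"
proof (induction m)
  case 0
  show ?case by simp
next
  case (Suc m)
  let ?s = "2 * pi * real m"
  let ?q = "(1 / 4 + real m) / (3 / 4 + real m)"
  \<comment> \<open>Subtracting the functional equations at \<open>?s\<close> and
    \<open>?s + pi\<close> eliminates the value at \<open>?s + pi\<close> and advances the parameter
    by 2 pi. After cancelling 2 pi, the quotient of the two arguments is one more factor of the
    Pochhammer ratio.\<close>
  have "log_sech_integral ?s
      = 2 * pi * (ln (?s + pi / 2) - ln (?s + pi + pi / 2)) + log_sech_integral (2 * pi * real (Suc m))"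
    using log_sech_functional_equation[of ?s] log_sech_functional_equation[of "?s + pi"]
    by (simp add: algebra_simps)
  also have "ln (?s + pi / 2) - ln (?s + pi + pi / 2) = ln ((?s + pi / 2) / (?s + pi + pi / 2))"
    by (intro ln_divide_pos[symmetric] add_nonneg_pos add_nonneg_nonneg) auto
  also have "(?s + pi / 2) / (?s + pi + pi / 2) = (2 * pi * (1 / 4 + real m)) / (2 * pi * (3 / 4 + real m))"
    by (simp add: algebra_simps)
  also have "\<dots> = ?q" by (rule mult_divide_mult_cancel_left) simp
  finally have step: "log_sech_integral ?s = 2 * pi * ln ?q + log_sech_integral (2 * pi * real (Suc m))" .
  have "pochhammer (1 / 4) (Suc m) / pochhammer (3 / 4) (Suc m)
      = pochhammer (1 / 4) m / pochhammer (3 / 4) m * ?q"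
    by (simp add: pochhammer_Suc)
  moreover have "ln (pochhammer (1 / 4) m / pochhammer (3 / 4) m * ?q)
      = ln (pochhammer (1 / 4) m / pochhammer (3 / 4) m) + ln ?q"
    by (intro ln_mult_pos divide_pos_pos pochhammer_pos add_pos_nonneg) auto
  ultimately show ?case using Suc.IH step by (simp add: algebra_simps)
qed

text \<open>In the quotient of Euler's sequences for Gamma at 3 / 4 and 1 / 4 the factorials cancel,
  leaving the Pochhammer ratio times the square root of \<open>n\<close>. This root absorbs the
  \<open>pi * ln n\<close> in the asymptotics of the remainder, whose constant
  \<open>pi * ln (2 * pi)\<close> supplies the factor \<open>sqrt (2 * pi)\<close>.\<close>

lemma log_sech_integral_0:
  "log_sech_integral 0 = 2 * pi * ln (sqrt (2 * pi) * Gamma (3 / 4) / Gamma (1 / 4))"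
proof (rule LIMSEQ_unique)
  define P :: "nat \<Rightarrow> real" where "P n = pochhammer (1 / 4) n / pochhammer (3 / 4) n" for n
  \<comment> \<open>The index \<open>Suc n\<close> keeps the argument of the logarithm positive, so
    that \<open>ln (2 * pi * real (Suc n))\<close> can be split.\<close>
  define R where "R n = log_sech_integral (2 * pi * real (Suc n)) - pi * ln (2 * pi * real (Suc n))" for n
  define r :: real where "r = Gamma (3 / 4) / Gamma (1 / 4)"
  have r: "r > 0" by (simp add: r_def Gamma_real_pos)
  have P: "P n > 0" for n unfolding P_def by (intro divide_pos_pos pochhammer_pos) auto
  have "(\<lambda>n. Gamma_series' (3 / 4) n / Gamma_series' (1 / 4) n) \<longlonglongrightarrow> r"
    unfolding r_def
    by (intro tendsto_divide Gamma_series'_LIMSEQ) (use Gamma_real_pos[of "1 / 4"] in linarith)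
  then have "(\<lambda>n. ln (Gamma_series' (3 / 4) (Suc n) / Gamma_series' (1 / 4) (Suc n))) \<longlonglongrightarrow> ln r"
    using r by (intro tendsto_ln) (auto intro: LIMSEQ_Suc)
  moreover have "ln (Gamma_series' (3 / 4) (Suc n) / Gamma_series' (1 / 4) (Suc n))
      = ln (P (Suc n)) + ln (real (Suc n)) / 2" for n
  proof -
    let ?e = "\<lambda>a. exp (a * ln (real (Suc n)))"
    have "Gamma_series' (3 / 4) (Suc n) / Gamma_series' (1 / 4) (Suc n)
        = P (Suc n) * (?e (3 / 4) / ?e (1 / 4))"
    proof -
      have cancel: "(F * a / p) / (F * b / q) = q / p * (a / b)" if "F \<noteq> 0" for F a b p q :: real
        using that by simp
      show ?thesis
        unfolding Gamma_series'_def P_def of_real_eq_id id_apply by (rule cancel) simp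
    qed
    also have "?e (3 / 4) / ?e (1 / 4) = exp (ln (real (Suc n)) / 2)"
      unfolding exp_diff[symmetric] by (simp add: field_simps)
    finally show ?thesis using P[of "Suc n"] by (simp add: ln_mult_pos)
  qed
  ultimately have lnP: "(\<lambda>n. ln (P (Suc n)) + ln (real (Suc n)) / 2) \<longlonglongrightarrow> ln r" by simp
  have R: "R \<longlonglongrightarrow> 0" unfolding R_def by (rule log_sech_integral_asymp) simp
  \<comment> \<open>Every term of this sequence equals \<open>log_sech_integral 0\<close>, regrouped
    so that each summand converges; the divergent logarithms cancel.\<close>
  have "(\<lambda>n. 2 * pi * (ln (P (Suc n)) + ln (real (Suc n)) / 2) + pi * ln (2 * pi) + R n)
      \<longlonglongrightarrow> 2 * pi * ln r + pi * ln (2 * pi) + 0"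
    by (intro tendsto_add tendsto_mult tendsto_const lnP R)
  moreover have "2 * pi * (ln (P (Suc n)) + ln (real (Suc n)) / 2) + pi * ln (2 * pi) + R n
      = log_sech_integral 0" for n
  proof -
    have "ln (2 * pi * real (Suc n)) = ln (2 * pi) + ln (real (Suc n))"
      by (intro ln_mult_pos) auto
    then show ?thesis
      using log_sech_integral_0_eq_pochhammer[of "Suc n"] by (simp add: R_def P_def distrib_left)
  qed
  moreover have "ln (sqrt (2 * pi) * Gamma (3 / 4) / Gamma (1 / 4)) = ln (2 * pi) / 2 + ln r"
  proof -
    have "ln (sqrt (2 * pi) * r) = ln (sqrt (2 * pi)) + ln r" using r by (intro ln_mult_pos) auto
    then show ?thesis by (simp add: r_def ln_sqrt)
  qed
  ultimately show "(\<lambda>n. log_sech_integral 0)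
      \<longlonglongrightarrow> 2 * pi * ln (sqrt (2 * pi) * Gamma (3 / 4) / Gamma (1 / 4))"
    by (simp add: algebra_simps)
qed simp

section \<open>Change of variables to the unit interval\<close>

theorem corollary3p2:
  "((\<lambda>x::real. ln (- ln x) * (1 / (1 + x\<^sup>2))) has_integral
      pi / 2 * ln (sqrt (2 * pi) * Gamma (3 / 4) / Gamma (1 / 4))) {0<..<1}"
proof -
  let ?f = "\<lambda>x::real. ln (- ln x) * (1 / (1 + x\<^sup>2))"
  let ?I = "pi / 2 * ln (sqrt (2 * pi) * Gamma (3 / 4) / Gamma (1 / 4))"
  \<comment> \<open>The factor 1 / 4 combines \<open>ln t = ln (t^2) / 2\<close> with
    \<open>exp (- t) / (1 + exp (- 2 * t)) = 1 / (2 * cosh t)\<close>. Writing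
    \<open>0\<^sup>2 + t\<^sup>2\<close> matches the unfolded
    \<open>log_sech_integral 0\<close>.\<close>
  let ?h = "\<lambda>t::real. (1 / 4) * (ln (0\<^sup>2 + t\<^sup>2) / cosh t)"
  have pullback: "\<bar>- exp (- t)\<bar> * ?f (exp (- t)) = ?h t" if "t \<in> {0<..}" for t
  proof -
    have "exp (- t) * (1 / (1 + (exp (- t))\<^sup>2)) = 1 / (2 * cosh t)"
    proof -
      have "exp (- t) * (2 * cosh t) = 1 + (exp (- t))\<^sup>2"
        by (simp add: cosh_field_def power2_eq_square ring_distribs exp_minus)
      moreover have "1 + (exp (- t))\<^sup>2 \<noteq> 0" by (simp add: add_nonneg_eq_0_iff)
      ultimately show ?thesis by (simp add: divide_simps)
    qed
    moreover have "ln (t\<^sup>2) = 2 * ln t" using that by (simp add: ln_realpow)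
    ultimately show ?thesis by simp (simp add: field_simps)
  qed
  have "?h absolutely_integrable_on {0<..}"
    by (intro set_integrable_mult_right log_sech_absolutely_integrable)
  moreover have "integral {0<..} ?h = ?I"
    using log_sech_integral_0 unfolding log_sech_integral_def integral_mult_right by simp
  moreover have "(\<lambda>t. \<bar>- exp (- t)\<bar> * ?f (exp (- t))) absolutely_integrable_on {0<..}
      \<longleftrightarrow> ?h absolutely_integrable_on {0<..}"
    by (rule set_integrable_cong[OF refl refl pullback])
  moreover have "integral {0<..} (\<lambda>t. \<bar>- exp (- t)\<bar> * ?f (exp (- t))) = integral {0<..} ?h"
    by (rule integral_cong[OF pullback])
  ultimately have "(\<lambda>t. \<bar>- exp (- t)\<bar> * ?f (exp (- t))) absolutely_integrable_on {0<..} \<and>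
      integral {0<..} (\<lambda>t. \<bar>- exp (- t)\<bar> * ?f (exp (- t))) = ?I"
    by (simp only: simp_thms)
  moreover have "inj_on (\<lambda>t::real. exp (- t)) {0<..}" by (auto simp: inj_on_def)
  moreover have "((\<lambda>t. exp (- t)) has_field_derivative - exp (- t)) (at t within {0<..})" for t :: real
    by (auto intro!: derivative_eq_intros)
  moreover have "(\<lambda>t::real. exp (- t)) ` {0<..} = {0<..<1}"
  proof safe
    fix x :: real assume "x \<in> {0<..<1}"
    then have "x = exp (- (- ln x))" "- ln x \<in> {0<..}" by auto
    then show "x \<in> (\<lambda>t. exp (- t)) ` {0<..}" by blast
  qed auto
  ultimately have "?f absolutely_integrable_on {0<..<1} \<and> integral {0<..<1} ?f = ?I"
    using has_absolute_integral_change_of_variables_1'[of "{0<..}" "\<lambda>t. exp (- t)" "\<lambda>t. - exp (- t)" ?f ?I]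
    by simp
  then have "?f integrable_on {0<..<1}" "integral {0<..<1} ?f = ?I"
    using set_lebesgue_integral_eq_integral(1) by blast+
  then show ?thesis by (simp only: has_integral_integrable_integral)
qed

end
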